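(* Let $x$ and $y$ be indeterminates, let $K=\mathbb{Q}(x,y)$, and let $F_n(x,y)$, $n\ge0$, be the Savage-Viswanathan polynomials. Let $M$ be the exponential Riordan array $$M=\left[\frac{1}{(1+z)^y},\ \frac{1}{1-x}\ln\left(\frac{1+z}{1+xz}\right)\right]$$ over $K$. Then $M$ is the coefficient array of a family of orthogonal polynomials over $K$ whose moments are the Savage-Viswanathan polynomials $(F_n(x,y))_{n\ge 0}$. Moreover, the inverse matrix of $M$ is the exponential Riordan array $$M^{-1}=\left[\left(\frac{1-x}{e^{z(x-1)}-x}\right)^y,\ \frac{e^{z}-e^{xz}}{e^{xz}-xe^{z}}\right],$$ and the Savage-Viswanathan polynomials appear as its initial column, i.e. $(M^{-1})_{n,0}=F_n(x,y)$ for all $n\ge 0$.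
   Context: The Savage-Viswanathan polynomials $F_n(x,y)$ are defined by the exponential generating function $\sum_{n\ge 0}F_n(x,y)\frac{z^n}{n!}=\left(\frac{1-x}{e^{z(x-1)}-x}\right)^y$ (a formal power series in $z$; the base has constant term $1$). They are polynomials in $x,y$. All series are formal power series in $z$; for a series $u$ with constant term $1$, $u^{c}=\exp(c\ln u)$. For formal power series $g(z)$ with $g(0)\ne 0$ and $f(z)=f_1z+f_2z^2+\cdots$ with $f_1\neq 0$, the exponential Riordan array $[g,f]$ is the infinite lower-triangular matrix $(a_{n,j})_{n,j\ge 0}$ whose $j$-th column has exponential generating function $g(z)f(z)^j/j!$, i.e. $a_{n,j}=n!\,[z^n]\,g(z)f(z)^j/j!$. A lower-triangular matrix $(a_{n,j})$ is the coefficient array of the polynomials $p_n(z)=\sum_{j=0}^n a_{n,j}z^j$. A sequence of monic polynomials $(p_n)_{n\ge0}$ over a field $K$ with $\deg p_n=n$ is (formally) orthogonal with moments $(\mu_n)_{n\ge 0}$ if the $K$-linear functional $\mathcal{L}$ on $K[z]$ with $\mathcal{L}(z^n)=\mu_n$ satisfies $\mathcal{L}(p_mp_n)=0$ for $m\neq n$ and $\mathcal{L}(p_n^2)\ne 0$ for all $n$. *)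

theory Defs
  imports "HOL-Computational_Algebra.Computational_Algebra"
begin

text \<open>The field \<open>\<rat>(x, y)\<close>, as the fraction field of \<open>\<rat>[x][y]\<close>.\<close>

type_synonym ratfun_xy = "rat poly poly fract"

definition indet_x :: ratfun_xy where
  "indet_x = to_fract [:[:0, 1:]:]"

definition indet_y :: ratfun_xy where
  "indet_y = to_fract [:0, 1:]"

text \<open>
  Logarithm and powers \<open>u\<^sup>c = exp (c ln u)\<close> of a series \<open>u\<close>; both are meaningful only if the
  constant term of \<open>u\<close> is \<open>1\<close>. Here \<open>fps_ln 1\<close> is the series of \<open>ln (1 + z)\<close>.
\<close>

definition fps_log :: "'a :: field_char_0 fps \<Rightarrow> 'a fps" where
  "fps_log u = fps_ln 1 oo (u - 1)"

definition fps_powr :: "'a :: field_char_0 fps \<Rightarrow> 'a \<Rightarrow> 'a fps" where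
  "fps_powr u c = fps_exp 1 oo (fps_const c * fps_log u)"

text \<open>
  Values of the Savage-Viswanathan polynomials at \<open>(x, y)\<close> with \<open>x \<noteq> 1\<close> (the generating function
  degenerates at \<open>x = 1\<close>). The polynomials themselves, as elements of \<open>\<rat>(x, y)\<close>, are obtained by
  taking \<open>indet_x\<close> and \<open>indet_y\<close> for the arguments.
\<close>

definition savage_viswanathan_egf :: "'a :: field_char_0 \<Rightarrow> 'a \<Rightarrow> 'a fps" where
  "savage_viswanathan_egf x y =
     fps_powr (fps_const (1 - x) / (fps_exp (x - 1) - fps_const x)) y"

definition savage_viswanathan :: "'a :: field_char_0 \<Rightarrow> 'a \<Rightarrow> nat \<Rightarrow> 'a" where
  "savage_viswanathan x y n = fact n * savage_viswanathan_egf x y $ n"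

definition riordan_pair :: "'a :: field_char_0 fps \<Rightarrow> 'a fps \<Rightarrow> bool" where
  "riordan_pair g f \<longleftrightarrow> g $ 0 \<noteq> 0 \<and> f $ 0 = 0 \<and> f $ 1 \<noteq> 0"

definition exp_riordan :: "'a :: field_char_0 fps \<Rightarrow> 'a fps \<Rightarrow> nat \<Rightarrow> nat \<Rightarrow> 'a" where
  "exp_riordan g f n j = fact n * ((g * f ^ j) $ n / fact j)"

definition lower_triangular :: "(nat \<Rightarrow> nat \<Rightarrow> 'a :: zero) \<Rightarrow> bool" where
  "lower_triangular A \<longleftrightarrow> (\<forall>n j. n < j \<longrightarrow> A n j = 0)"

text \<open>
  Product of infinite lower-triangular matrices: if \<open>A\<close> is lower triangular, the terms with
  \<open>k > n\<close> of the row-column product vanish.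
\<close>

definition lt_mult ::
  "(nat \<Rightarrow> nat \<Rightarrow> 'a :: comm_ring_1) \<Rightarrow> (nat \<Rightarrow> nat \<Rightarrow> 'a) \<Rightarrow> nat \<Rightarrow> nat \<Rightarrow> 'a" where
  "lt_mult A B n j = (\<Sum>k\<le>n. A n k * B k j)"

definition lt_one :: "nat \<Rightarrow> nat \<Rightarrow> 'a :: comm_ring_1" where
  "lt_one n j = (if n = j then 1 else 0)"

definition lt_inverse :: "(nat \<Rightarrow> nat \<Rightarrow> 'a :: comm_ring_1) \<Rightarrow> (nat \<Rightarrow> nat \<Rightarrow> 'a) \<Rightarrow> bool" where
  "lt_inverse A B \<longleftrightarrow> lower_triangular A \<and> lower_triangular B \<and>
     lt_mult A B = lt_one \<and> lt_mult B A = lt_one"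

definition coefficient_array ::
  "(nat \<Rightarrow> nat \<Rightarrow> 'a :: comm_ring_1) \<Rightarrow> (nat \<Rightarrow> 'a poly) \<Rightarrow> bool" where
  "coefficient_array A p \<longleftrightarrow> lower_triangular A \<and> (\<forall>n. p n = (\<Sum>j\<le>n. monom (A n j) j))"

definition moment_functional :: "(nat \<Rightarrow> 'a :: field) \<Rightarrow> 'a poly \<Rightarrow> 'a" where
  "moment_functional \<mu> p = (\<Sum>i\<le>degree p. coeff p i * \<mu> i)"

definition orthogonal_with_moments :: "(nat \<Rightarrow> 'a :: field poly) \<Rightarrow> (nat \<Rightarrow> 'a) \<Rightarrow> bool" where
  "orthogonal_with_moments p \<mu> \<longleftrightarrow>
     (\<forall>n. degree (p n) = n \<and> lead_coeff (p n) = 1) \<and>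
     (\<forall>m n. m \<noteq> n \<longrightarrow> moment_functional \<mu> (p m * p n) = 0) \<and>
     (\<forall>n. moment_functional \<mu> (p n ^ 2) \<noteq> 0)"

text \<open>\<open>moment_functional \<mu>\<close> is indeed the linear functional sending the \<open>n\<close>-th power to \<open>\<mu> n\<close>.\<close>

lemma moment_functional_altdef:
  assumes "degree p \<le> N"
  shows "moment_functional \<mu> p = (\<Sum>i\<le>N. coeff p i * \<mu> i)"
  unfolding moment_functional_def
  by (rule sum.mono_neutral_left) (use assms in \<open>auto simp: coeff_eq_0\<close>)

lemma moment_functional_monom_1: "moment_functional \<mu> (monom 1 n) = \<mu> n"
proof -
  have "moment_functional \<mu> (monom 1 n) = (\<Sum>i\<le>n. coeff (monom 1 n) i * \<mu> i)"
    by (rule moment_functional_altdef) (rule degree_monom_le)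
  also have "\<dots> = (\<Sum>i\<le>n. if i = n then \<mu> i else 0)"
    by (rule sum.cong) auto
  finally show ?thesis by simp
qed

lemma linear_moment_functional: "Vector_Spaces.linear smult (*) (moment_functional \<mu>)"
proof (unfold_locales, goal_cases)
  case (9 p q)
  define N where "N = max (degree p) (degree q)"
  have "degree p \<le> N" "degree q \<le> N" "degree (p + q) \<le> N"
    by (auto simp: N_def degree_add_le)
  then show ?case
    by (simp add: moment_functional_altdef[of _ N] algebra_simps sum.distrib)
next
  case (10 c p)
  show ?case
    by (simp add: moment_functional_altdef[of _ "degree p"] degree_smult_le
        sum_distrib_left mult.assoc del: degree_smult_eq)
qed (auto simp: algebra_simps smult_add_left smult_add_right)

end

theory Submission
  imports Defs
begin

text \<open>
  Composition of exponential Riordan arrays (the fundamental theorem of Riordan arrays) reduces the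
  inversion to the identities \<open>f' \<circ> f = z\<close> and \<open>g \<cdot> (g' \<circ> f) = 1\<close>, both of which follow from
  \<open>exp ((x - 1) f) = (1 + x z) / (1 + z)\<close>. For the orthogonality, \<open>G = g exp (t f)\<close>, the
  exponential generating function of the row polynomials \<open>p\<^sub>n(t)\<close>, satisfies
  \<open>(1 + z) (1 + x z) \<partial>G/\<partial>z = (t - y (1 + x z)) G\<close>, which amounts to
  \[ p_{n+1} = (t - y - (1 + x) n) p_n - x n (n - 1 + y) p_{n-1}. \]
  The functional with the moments \<open>F\<^sub>n = (M\<^sup>-\<^sup>1)\<^sub>n\<^sub>,\<^sub>0\<close> satisfies \<open>L(p\<^sub>n) = (M M\<^sup>-\<^sup>1)\<^sub>n\<^sub>,\<^sub>0 = \<delta>\<^sub>n\<^sub>,\<^sub>0\<close>, and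
  then orthogonality follows from the recurrence as in Favard's theorem, because
  \<open>x n (n - 1 + y) \<noteq> 0\<close> for \<open>n \<ge> 1\<close>.
\<close>

section \<open>Logarithms, powers and compositional inverses of formal power series\<close>

lemma fps_log_nth_0 [simp]: "fps_log u $ 0 = 0"
  by (simp add: fps_log_def)

lemma fps_powr_nth_0 [simp]: "fps_powr u c $ 0 = 1"
  by (simp add: fps_powr_def)

text \<open>\<open>fps_ln 1\<close> is the compositional inverse of \<open>fps_exp 1 - 1\<close>;
  composing that identity with \<open>u - 1\<close> gives the claim.\<close>

lemma fps_exp_compose_log:
  fixes u :: "'a :: field_char_0 fps"
  assumes "u $ 0 = 1"
  shows "fps_exp 1 oo fps_log u = u"
proof -
  have "(fps_exp 1 - 1) oo fps_ln 1 = (fps_X :: 'a fps)"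
    by (simp add: fps_ln_fps_exp_inv fps_inv_right)
  then have "fps_exp 1 oo fps_ln 1 = 1 + (fps_X :: 'a fps)"
    by (simp add: fps_compose_sub_distrib algebra_simps)
  then have "fps_exp 1 oo fps_log u = (1 + fps_X) oo (u - 1)"
    using assms by (simp add: fps_log_def fps_compose_assoc)
  also have "\<dots> = u"
    using assms by (simp add: fps_compose_add_distrib)
  finally show ?thesis .
qed

lemma fps_deriv_log:
  fixes u :: "'a :: field_char_0 fps"
  assumes "u $ 0 = 1"
  shows "fps_deriv (fps_log u) = fps_deriv u * inverse u"
proof -
  have "(inverse (1 + fps_X) oo (u - 1)) = inverse u"
    using assms by (subst fps_inverse_compose) (simp_all add: fps_compose_add_distrib)
  then show ?thesis
    using assms by (simp add: fps_log_def fps_compose_deriv fps_ln_deriv mult.commute)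
qed

lemma fps_deriv_powr:
  fixes u :: "'a :: field_char_0 fps"
  assumes "u $ 0 = 1"
  shows "fps_deriv (fps_powr u c) = fps_const c * fps_powr u c * (fps_deriv u * inverse u)"
  using assms by (simp add: fps_powr_def fps_compose_deriv fps_deriv_log mult_ac)

lemma fps_powr_compose:
  fixes u v :: "'a :: field_char_0 fps"
  assumes "u $ 0 = 1" "v $ 0 = 0"
  shows "fps_powr u c oo v = fps_powr (u oo v) c"
proof -
  have "fps_log u oo v = fps_log (u oo v)"
    using assms by (simp add: fps_log_def fps_compose_assoc [symmetric] fps_compose_sub_distrib)
  moreover have "fps_powr u c oo v = fps_exp 1 oo ((fps_const c * fps_log u) oo v)"
    unfolding fps_powr_def using assms by (intro fps_compose_assoc [symmetric]) simp_all
  ultimately show ?thesis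
    using assms by (simp add: fps_powr_def fps_const_mult_apply_left [symmetric])
qed

text \<open>Tailored to \<open>c = x - 1\<close>, where \<open>- 1 / c\<close> is the factor
  \<open>1 / (1 - x)\<close> in \<open>f\<close>: it evaluates exp ((x - 1) f).\<close>

lemma fps_exp_compose_scaled_log:
  fixes u :: "'a :: field_char_0 fps"
  assumes "u $ 0 = 1" "c \<noteq> 0"
  shows "fps_exp c oo (fps_const (- 1 / c) * fps_log u) = inverse u"
proof -
  let ?v = "fps_const (- 1 / c) * fps_log u"
  \<comment> \<open>Splitting off only the scaling by \<open>- c\<close> lets it cancel against
    \<open>- 1 / c\<close>; the remaining sign turns the exponential into a reciprocal.\<close>
  have "fps_exp c oo ?v = fps_exp (- 1) oo (fps_const (- c) * fps_X) oo ?v"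
    by simp
  also have "\<dots> = fps_exp (- 1) oo ((fps_const (- c) * fps_X) oo ?v)"
    by (intro fps_compose_assoc [symmetric]) simp_all
  also have "(fps_const (- c) * fps_X) oo ?v = fps_const (- c) * ?v"
    by (simp only: fps_const_mult_apply_left [symmetric]) simp
  also have "\<dots> = fps_log u"
    using assms by (simp add: mult.assoc [symmetric] del: fps_const_neg)
  also have "fps_exp (- 1) oo fps_log u = inverse (fps_exp 1 oo fps_log u)"
    unfolding fps_exp_neg by (subst fps_inverse_compose) simp_all
  finally show ?thesis
    using assms by (simp add: fps_exp_compose_log)
qed

text \<open>As in a monoid: \<open>fps_inv f\<close> is a right inverse of \<open>f\<close>, so
  associativity forces the left inverse \<open>h\<close> to equal it.\<close>

lemma fps_compose_inverse_commute:
  fixes f h :: "'a :: field fps"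
  assumes "f $ 0 = 0" "f $ 1 \<noteq> 0" "h oo f = fps_X"
  shows "f oo h = fps_X"
proof -
  have i0: "fps_inv f $ 0 = 0"
    by (simp add: fps_inv_def)
  have r: "f oo fps_inv f = fps_X"
    using assms by (intro fps_inv_right)
  have "h = h oo (f oo fps_inv f)"
    by (simp add: r)
  also have "\<dots> = h oo f oo fps_inv f"
    using assms i0 by (intro fps_compose_assoc)
  also have "\<dots> = fps_inv f"
    using assms i0 by simp
  finally show ?thesis
    using r by simp
qed

section \<open>Exponential Riordan arrays: products and inverses\<close>

lemma exp_riordan_eq_0:
  assumes "f $ 0 = 0" "n < j"
  shows "exp_riordan g f n j = 0"
proof -
  have "(g * f ^ j) $ n = 0"
    unfolding fps_mult_nth
    using assms by (intro sum.neutral ballI) (simp add: startsby_zero_power_prefix)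
  then show ?thesis
    by (simp add: exp_riordan_def)
qed

lemma lower_triangular_exp_riordan:
  "f $ 0 = 0 \<Longrightarrow> lower_triangular (exp_riordan g f)"
  by (simp add: lower_triangular_def exp_riordan_eq_0)

lemma exp_riordan_diag:
  assumes "f $ 0 = 0"
  shows "exp_riordan g f n n = g $ 0 * (f $ 1) ^ n"
proof -
  have "(g * f ^ n) $ n = (\<Sum>i=0..n. if i = 0 then g $ 0 * (f $ 1) ^ n else 0)"
    unfolding fps_mult_nth using assms
    by (intro sum.cong)
      (simp_all add: startsby_zero_power_prefix startsby_zero_power_nth_same)
  then show ?thesis
    by (simp add: exp_riordan_def)
qed

text \<open>Since \<open>f ^ k\<close> has order at least \<open>k\<close>, expanding
  \<open>h oo f\<close> in powers of \<open>f\<close> contributes to coefficient \<open>n\<close>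
  only for \<open>k \<le> n\<close>. This is the row-times-column sum of a Riordan product.\<close>

lemma fps_mult_compose_nth:
  fixes f :: "'a :: idom fps"
  assumes "f $ 0 = 0"
  shows "(g * (h oo f)) $ n = (\<Sum>k\<le>n. h $ k * (g * f ^ k) $ n)"
proof -
  have "(g * (h oo f)) $ n = (\<Sum>i=0..n. g $ i * (\<Sum>k=0..n. h $ k * f ^ k $ (n - i)))"
    unfolding fps_mult_nth fps_compose_nth using assms
    by (intro sum.cong refl arg_cong2 [where f = "(*)"] sum.mono_neutral_left)
      (auto simp: startsby_zero_power_prefix)
  also have "\<dots> = (\<Sum>k=0..n. \<Sum>i=0..n. h $ k * (g $ i * f ^ k $ (n - i)))"
    unfolding sum_distrib_left by (subst sum.swap) (simp add: mult_ac)
  finally show ?thesis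
    by (simp add: fps_mult_nth sum_distrib_left atLeast0AtMost)
qed

text \<open>The factor \<open>fact k\<close> in row \<open>k\<close> of the right array cancels
  \<open>1 / fact k\<close> in column \<open>k\<close> of the left one, leaving the expansion of a
  composition.\<close>

lemma lt_mult_exp_riordan:
  assumes "f $ 0 = 0"
  shows "lt_mult (exp_riordan g f) (exp_riordan h l) = exp_riordan (g * (h oo f)) (l oo f)"
proof (intro ext)
  fix n j
  have "lt_mult (exp_riordan g f) (exp_riordan h l) n j =
      fact n / fact j * (\<Sum>k\<le>n. (h * l ^ j) $ k * (g * f ^ k) $ n)"
    unfolding lt_mult_def exp_riordan_def sum_distrib_left by (intro sum.cong) simp_all
  also have "(\<Sum>k\<le>n. (h * l ^ j) $ k * (g * f ^ k) $ n) = (g * (h oo f) * (l oo f) ^ j) $ n"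
    using assms
    by (simp add: fps_mult_compose_nth [symmetric] fps_compose_mult_distrib fps_compose_power
        mult.assoc)
  also have "fact n / fact j * \<dots> = exp_riordan (g * (h oo f)) (l oo f) n j"
    by (simp add: exp_riordan_def)
  finally show "lt_mult (exp_riordan g f) (exp_riordan h l) n j =
      exp_riordan (g * (h oo f)) (l oo f) n j" .
qed

lemma exp_riordan_1_X: "exp_riordan 1 fps_X = lt_one"
  by (intro ext) (simp add: exp_riordan_def lt_one_def)

text \<open>The two hypotheses give one product of arrays. For the other, \<open>l\<close> is also a
  right inverse of \<open>f\<close>, and composing \<open>g * (h oo f) = 1\<close> with
  \<open>l\<close> yields \<open>h * (g oo l) = 1\<close>.\<close>

lemma lt_inverse_exp_riordan:
  assumes "f $ 0 = 0" "f $ 1 \<noteq> 0" "l $ 0 = 0" and lf: "l oo f = fps_X" and gh: "g * (h oo f) = 1"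
  shows "lt_inverse (exp_riordan g f) (exp_riordan h l)"
proof -
  have fl: "f oo l = fps_X"
    using assms(1,2) lf by (rule fps_compose_inverse_commute)
  have "h = h oo (f oo l)"
    by (simp add: fl)
  also have "\<dots> = h oo f oo l"
    using assms by (intro fps_compose_assoc)
  finally have "h * (g oo l) = (g oo l) * (h oo f oo l)"
    by (simp add: mult.commute)
  also have "\<dots> = (g * (h oo f)) oo l"
    using assms(3) by (rule fps_compose_mult_distrib [symmetric])
  finally have "h * (g oo l) = 1"
    by (simp add: gh)
  then show ?thesis
    using assms fl
    by (simp add: lt_inverse_def lower_triangular_exp_riordan lt_mult_exp_riordan exp_riordan_1_X)
qed

section \<open>Moment functionals and Favard's theorem\<close>

lemma moment_functional_add:
  "moment_functional \<mu> (p + q) = moment_functional \<mu> p + moment_functional \<mu> q"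
  by (rule linear_moment_functional [THEN Vector_Spaces.linear.axioms(3),
      THEN module_hom.add])

lemma moment_functional_smult:
  "moment_functional \<mu> (smult c p) = c * moment_functional \<mu> p"
  by (rule linear_moment_functional [THEN Vector_Spaces.linear.axioms(3),
      THEN module_hom.scale])

lemma moment_functional_0 [simp]: "moment_functional \<mu> 0 = 0"
  by (simp add: moment_functional_def)

lemma moment_functional_sum:
  "moment_functional \<mu> (sum p A) = (\<Sum>i\<in>A. moment_functional \<mu> (p i))"
  by (induction A rule: infinite_finite_induct) (simp_all add: moment_functional_add)

lemma moment_functional_monom: "moment_functional \<mu> (monom c n) = c * \<mu> n"
  using moment_functional_smult [of \<mu> c "monom 1 n"]
  by (simp add: smult_monom moment_functional_monom_1)

lemma moment_functional_mult:
  "moment_functional \<mu> (p * q) =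
    (\<Sum>i\<le>degree p. coeff p i * moment_functional \<mu> (monom 1 i * q))"
proof -
  have "p * q = (\<Sum>i\<le>degree p. smult (coeff p i) (monom 1 i * q))"
    by (subst poly_as_sum_of_monoms [of p, symmetric])
      (simp add: sum_distrib_right smult_monom mult_smult_left [symmetric] del: mult_smult_left)
  then show ?thesis
    by (simp add: moment_functional_sum moment_functional_smult)
qed

text \<open>Multiplying the recurrence by powers of z shows by induction that L(z^k p_n) = 0 for k <
  n and L(z^(n+1) p_(n+1)) = c_n L(z^n p_n). Expanding one factor of a product in monomials then
  gives orthogonality, and monicity identifies L(p_n^2) with L(z^n p_n).\<close>

lemma favard:
  fixes p :: "nat \<Rightarrow> 'a :: field poly" and b c :: "nat \<Rightarrow> 'a"
  assumes deg: "\<And>n. degree (p n) = n" and monic: "\<And>n. lead_coeff (p n) = 1"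
    and L0: "moment_functional \<mu> (p 0) \<noteq> 0"
    and L: "\<And>n. n > 0 \<Longrightarrow> moment_functional \<mu> (p n) = 0"
    and rec: "\<And>n. monom 1 1 * p (Suc n) =
      p (Suc (Suc n)) + smult (b n) (p (Suc n)) + smult (c n) (p n)"
    and c: "\<And>n. c n \<noteq> 0"
  shows "orthogonal_with_moments p \<mu>"
proof -
  have step: "moment_functional \<mu> (monom 1 (Suc k) * p (Suc n)) =
      moment_functional \<mu> (monom 1 k * p (Suc (Suc n))) +
      b n * moment_functional \<mu> (monom 1 k * p (Suc n)) +
      c n * moment_functional \<mu> (monom 1 k * p n)" for k n
  proof -
    have "monom 1 (Suc k) * p (Suc n) = monom 1 k * (monom 1 1 * p (Suc n))"
      by (simp add: mult.assoc [symmetric] mult_monom)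
    then show ?thesis
      by (simp only: rec) (simp add: distrib_left moment_functional_add moment_functional_smult)
  qed
  have low: "moment_functional \<mu> (monom 1 k * p n) = 0" if "k < n" for k n
    using that
  proof (induction k arbitrary: n)
    case 0
    then show ?case by (simp add: L monom_0)
  next
    case (Suc k)
    then obtain m where "n = Suc m" "k < m"
      by (cases n) auto
    then show ?case
      by (simp only: step Suc.IH less_SucI mult_zero_right add_0_right)
  qed
  have diag: "moment_functional \<mu> (monom 1 n * p n) \<noteq> 0" for n
  proof (induction n)
    case 0
    then show ?case by (simp add: L0 monom_0)
  next
    case (Suc n)
    then show ?case by (simp add: step low c)
  qed
  have less: "moment_functional \<mu> (p m * p n) = 0" if "m < n" for m n
    using that by (simp add: moment_functional_mult [of \<mu> "p m"] deg low)
  have "moment_functional \<mu> (p n ^ 2) \<noteq> 0" for n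
  proof -
    have "moment_functional \<mu> (p n ^ 2) =
        (\<Sum>i\<le>n. if i = n then moment_functional \<mu> (monom 1 n * p n) else 0)"
      unfolding power2_eq_square moment_functional_mult [of \<mu> "p n"] deg
      using monic [of n] by (intro sum.cong) (auto simp: deg low)
    then show ?thesis
      using diag by simp
  qed
  moreover have "moment_functional \<mu> (p m * p n) = 0" if "m \<noteq> n" for m n
    using that less [of m n] less [of n m] by (cases "m < n") (auto simp: mult.commute)
  ultimately show ?thesis
    using deg monic by (simp add: orthogonal_with_moments_def)
qed

section \<open>Row polynomials\<close>

definition row_poly :: "(nat \<Rightarrow> nat \<Rightarrow> 'a :: comm_ring_1) \<Rightarrow> nat \<Rightarrow> 'a poly" where
  "row_poly A n = (\<Sum>j\<le>n. monom (A n j) j)"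

lemma coeff_row_poly:
  assumes "lower_triangular A"
  shows "coeff (row_poly A n) j = A n j"
proof -
  have "coeff (row_poly A n) j = (\<Sum>i\<le>n. if i = j then A n j else 0)"
    unfolding row_poly_def coeff_sum by (intro sum.cong) auto
  then show ?thesis
    using assms by (auto simp: lower_triangular_def)
qed

lemma moment_functional_row_poly:
  "moment_functional (\<lambda>k. B k 0) (row_poly A n) = lt_mult A B n 0"
  by (simp add: row_poly_def lt_mult_def moment_functional_sum moment_functional_monom)

section \<open>The Meixner-type pair: differential equations, inversion, orthogonality\<close>

context
  fixes x y :: "'a :: field_char_0" and g f g' f' :: "'a fps"
  assumes x: "x \<noteq> 1"
  defines "g \<equiv> 1 / fps_powr (1 + fps_X) y"
    and "f \<equiv> fps_const (1 / (1 - x)) * fps_log ((1 + fps_X) / (1 + fps_const x * fps_X))"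
    and "g' \<equiv> fps_powr (fps_const (1 - x) / (fps_exp (x - 1) - fps_const x)) y"
    and "f' \<equiv> (fps_exp 1 - fps_exp x) / (fps_exp x - fps_const x * fps_exp 1)"
begin

lemma meixner_deriv_f: "(1 + fps_X) * (1 + fps_const x * fps_X) * fps_deriv f = 1"
proof -
  let ?a = "1 + fps_X :: 'a fps" and ?b = "1 + fps_const x * fps_X"
  let ?u = "?a * inverse ?b"
  have ab: "?a * inverse ?a = 1" "?b * inverse ?b = 1"
    by (simp_all add: inverse_mult_eq_1')
  have inv_u: "inverse ?u = inverse ?a * ?b"
    by (simp add: fps_inverse_mult)
  have du: "fps_deriv ?u = inverse ?b + ?a * (- fps_const x * inverse ?b ^ 2)"
    by (simp add: fps_inverse_deriv)
  have c: "fps_const (1 / (1 - x)) * (1 - fps_const x) = 1"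
    using x by (simp add: fps_const_1_eq_1 [symmetric] fps_const_sub del: fps_const_1_eq_1)
  have "fps_deriv f = fps_const (1 / (1 - x)) * (fps_deriv ?u * inverse ?u)"
    unfolding f_def by (subst fps_divide_unit) (simp_all add: fps_deriv_log)
  \<comment> \<open>The products with inverses stay visible, so this is a ring identity with the
    inverses as independent atoms; they are cancelled only afterwards.\<close>
  then have "?a * ?b * fps_deriv f =
      fps_const (1 / (1 - x)) * (?a * inverse ?a) *
        (?b * inverse ?b) * (?b - (?b * inverse ?b) * fps_const x * ?a)"
    unfolding du inv_u by algebra
  also have "\<dots> = fps_const (1 / (1 - x)) * (1 - fps_const x)"
    by (simp only: ab) (simp add: algebra_simps)
  finally show ?thesis
    by (simp add: c)
qed

lemma meixner_deriv_g: "(1 + fps_X) * fps_deriv g = - (fps_const y * g)"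
proof -
  let ?P = "fps_powr (1 + fps_X) y"
  have X: "(1 + fps_X) * inverse (1 + fps_X :: 'a fps) = 1"
    by (simp add: inverse_mult_eq_1')
  have P: "?P * inverse ?P = 1"
    by (simp add: inverse_mult_eq_1')
  have g: "g = inverse ?P"
    unfolding g_def by (simp add: fps_divide_unit)
  have "(1 + fps_X) * fps_deriv g =
      - (fps_const y * (?P * inverse ?P) * ((1 + fps_X) * inverse (1 + fps_X)) * inverse ?P)"
    unfolding g by (simp add: fps_inverse_deriv fps_deriv_powr power2_eq_square algebra_simps)
  then show ?thesis
    by (simp only: X P) (simp add: g)
qed

lemma meixner_f_nth: "f $ 0 = 0" "f $ 1 = 1"
proof -
  show "f $ 0 = 0"
    by (simp add: f_def)
  \<comment> \<open>At z = 0 both polynomial factors are 1, so the constant term is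
    \<open>f $ 1\<close>.\<close>
  have "((1 + fps_X) * (1 + fps_const x * fps_X) * fps_deriv f) $ 0 = 1"
    by (subst meixner_deriv_f) simp
  then show "f $ 1 = 1"
    by simp
qed

lemma meixner_g_nth_0: "g $ 0 = 1"
  by (simp add: g_def)

lemma meixner_exp_compose_f:
  "(1 + fps_X) * (fps_exp (x - 1) oo f) = 1 + fps_const x * fps_X"
proof -
  let ?a = "1 + fps_X :: 'a fps" and ?b = "1 + fps_const x * fps_X"
  have "- 1 / (x - 1) = 1 / (1 - x)"
    using x by (simp add: divide_simps)
  then have "fps_exp (x - 1) oo f = inverse (?a / ?b)"
    using x fps_exp_compose_scaled_log [of "?a / ?b" "x - 1"] by (simp add: f_def)
  also have "\<dots> = ?b * inverse ?a"
    by (simp add: fps_divide_unit fps_inverse_mult)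
  finally show ?thesis
    by (simp add: inverse_mult_eq_1' mult.left_commute [of ?a])
qed

lemma one_minus_fps_const_neq_0: "1 - fps_const x \<noteq> 0"
  using x by simp

text \<open>Cancelling e^z gives f' = (1 - E) / (E - x) with E = e^((x-1)z). Substituting
  \<open>f\<close> turns E into (1 + xz) / (1 + z), and the quotient becomes z.\<close>

lemma meixner_f'_compose_f: "f' oo f = fps_X"
proof -
  let ?E = "fps_exp (x - 1)"
  have nz: "(fps_exp x - fps_const x * fps_exp 1) $ 0 \<noteq> 0"
    using x by simp
  have "f' * (fps_exp x - fps_const x * fps_exp 1) = fps_exp 1 - fps_exp x"
    unfolding f'_def fps_divide_unit [OF nz] mult.assoc inverse_mult_eq_1 [OF nz] by simp
  moreover have "fps_exp x = ?E * fps_exp 1"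
    by (simp add: fps_exp_add_mult [symmetric])
  ultimately have "fps_exp 1 * (f' * (?E - fps_const x)) = fps_exp 1 * (1 - ?E)"
    by (simp add: algebra_simps)
  then have "f' * (?E - fps_const x) = 1 - ?E"
    by simp
  then have "(f' * (?E - fps_const x)) oo f = (1 - ?E) oo f"
    by simp
  then have *: "(f' oo f) * ((?E oo f) - fps_const x) = 1 - (?E oo f)"
    by (simp add: fps_compose_mult_distrib fps_compose_sub_distrib meixner_f_nth)
  have "(f' oo f) * (1 - fps_const x) = fps_X * (1 - fps_const x)"
    using * meixner_exp_compose_f by algebra
  then show ?thesis
    using one_minus_fps_const_neq_0 by simp
qed

lemma meixner_f'_nth_0: "f' $ 0 = 0"
  using x by (simp add: f'_def)

text \<open>By the chain rule at 0, \<open>f' $ 1\<close> times \<open>f $ 1\<close> is 1.\<close>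

lemma meixner_f'_nth_1: "f' $ 1 \<noteq> 0"
proof -
  have "fps_deriv (f' oo f) $ 0 = 1"
    by (simp add: meixner_f'_compose_f)
  then show ?thesis
    by (auto simp: fps_compose_deriv meixner_f_nth)
qed

text \<open>Under substitution of \<open>f\<close>, the denominator E - x becomes (1 - x) / (1 + z),
  so the base of the power \<open>g'\<close> becomes 1 + z.\<close>

lemma meixner_g_mult_compose: "g * (g' oo f) = 1"
proof -
  let ?E = "fps_exp (x - 1)"
  let ?w = "fps_const (1 - x) / (?E - fps_const x)"
  have nz: "(?E - fps_const x) $ 0 \<noteq> 0"
    using x by simp
  have "?w * (?E - fps_const x) = fps_const (1 - x)"
    unfolding fps_divide_unit [OF nz] mult.assoc inverse_mult_eq_1 [OF nz] by simp
  then have "(?w * (?E - fps_const x)) oo f = fps_const (1 - x)"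
    by simp
  then have *: "(?w oo f) * ((?E oo f) - fps_const x) = 1 - fps_const x"
    by (simp add: fps_compose_mult_distrib fps_compose_sub_distrib meixner_f_nth)
  have "(?w oo f) * (1 - fps_const x) = (1 + fps_X) * (1 - fps_const x)"
    using * meixner_exp_compose_f by algebra
  then have w: "?w oo f = 1 + fps_X"
    using mult_right_cancel [OF one_minus_fps_const_neq_0] by blast
  have "g' oo f = fps_powr (1 + fps_X) y"
    unfolding g'_def using x w
    by (subst fps_powr_compose) (simp_all add: meixner_f_nth)
  then show ?thesis
    by (simp add: g_def fps_divide_unit inverse_mult_eq_1)
qed

lemma meixner_lt_inverse: "lt_inverse (exp_riordan g f) (exp_riordan g' f')"
  using meixner_f_nth meixner_f'_nth_0 meixner_f'_compose_f meixner_g_mult_compose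
  by (intro lt_inverse_exp_riordan) simp_all

text \<open>This is the coefficient of t^(j+1) in the differential equation for G, multiplied by
  (j+1)!. Working column by column avoids series in two variables; the quadratic factor is expanded
  for coefficient extraction.\<close>

lemma meixner_column_ode:
  "(1 + fps_const (1 + x) * fps_X + fps_const x * fps_X ^ 2) * fps_deriv (g * f ^ Suc j) =
    of_nat (Suc j) * (g * f ^ j) - fps_const y * (1 + fps_const x * fps_X) * (g * f ^ Suc j)"
  (is "?q * _ = _")
proof -
  let ?a = "1 + fps_X :: 'a fps" and ?b = "1 + fps_const x * fps_X"
  have q: "?q = ?a * ?b"
    by (simp add: algebra_simps power2_eq_square flip: fps_const_add)
  have "fps_deriv (f ^ Suc j) = of_nat (Suc j) * fps_deriv f * f ^ j"
    by (simp only: fps_deriv_power' diff_Suc_1)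
  then have "?q * fps_deriv (g * f ^ Suc j) =
      (?a * fps_deriv g) * (?b * f ^ Suc j) + of_nat (Suc j) * (?a * ?b * fps_deriv f) * (g * f ^ j)"
    unfolding q fps_deriv_mult by (simp only: algebra_simps)
  \<comment> \<open>The shape left once both derivative equations are substituted; the 1 stands for
    \<open>?a * ?b * fps_deriv f\<close>.\<close>
  moreover have "- (c * g) * (d * u) + m * 1 * v = m * v - c * d * (g * u)" for c d m u v :: "'a fps"
    by (simp add: algebra_simps)
  ultimately show ?thesis
    by (simp only: meixner_deriv_f meixner_deriv_g)
qed

lemma meixner_column_0_ode:
  "(1 + fps_const (1 + x) * fps_X + fps_const x * fps_X ^ 2) * fps_deriv g =
    - (fps_const y * (1 + fps_const x * fps_X) * g)"
  (is "?q * _ = _")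
proof -
  let ?a = "1 + fps_X :: 'a fps" and ?b = "1 + fps_const x * fps_X"
  have "?q * fps_deriv g = ?b * (?a * fps_deriv g)"
    by (simp add: algebra_simps power2_eq_square flip: fps_const_add)
  then show ?thesis
    unfolding meixner_deriv_g by algebra
qed

text \<open>Compares coefficients of z^(n+1) in the column equations. Up to an affine change of the
  variable t, this is the recurrence of the monic Meixner polynomials with parameters beta = y and c
  = x.\<close>

lemma meixner_recurrence:
  fixes M
  defines "M \<equiv> exp_riordan g f"
  shows "M (Suc (Suc n)) (Suc j) = M (Suc n) j - (y + (1 + x) * of_nat (Suc n)) * M (Suc n) (Suc j) -
      x * of_nat (Suc n) * (of_nat n + y) * M n (Suc j)"
    and "M (Suc (Suc n)) 0 = - (y + (1 + x) * of_nat (Suc n)) * M (Suc n) 0 -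
      x * of_nat (Suc n) * (of_nat n + y) * M n 0"
proof -
  have coeff_lhs: "((1 + fps_const (1 + x) * fps_X + fps_const x * fps_X ^ 2) * fps_deriv a) $ Suc n =
      of_nat (Suc (Suc n)) * a $ Suc (Suc n) + (1 + x) * (of_nat (Suc n) * a $ Suc n) +
      x * (of_nat n * a $ n)" for a
    \<comment> \<open>For \<open>n = 0\<close> the quadratic term does not reach this coefficient,
      in agreement with the factor \<open>of_nat n\<close>.\<close>
    by (cases n) (simp_all add: distrib_right mult.assoc fps_X_power_mult_nth
      del: fps_const_add of_nat_Suc)
  have coeff_rhs: "(fps_const y * (1 + fps_const x * fps_X) * a) $ Suc n =
      y * (a $ Suc n + x * a $ n)" for a
    by (simp add: distrib_right mult.assoc)
  define a b where "a = g * f ^ Suc j" and "b = g * f ^ j"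
  have M: "M k 0 = fact k * g $ k" "M k j = fact k * b $ k / fact j"
    "M k (Suc j) = fact k * a $ k / fact (Suc j)" for k
    by (simp_all add: M_def exp_riordan_def a_def b_def)
  have "of_nat (Suc (Suc n)) * a $ Suc (Suc n) =
      of_nat (Suc j) * b $ Suc n - y * (a $ Suc n + x * a $ n) -
      (1 + x) * (of_nat (Suc n) * a $ Suc n) - x * (of_nat n * a $ n)"
    using arg_cong [OF meixner_column_ode [of j], of "\<lambda>u. u $ Suc n"]
    unfolding a_def [symmetric] b_def [symmetric] fps_sub_nth coeff_lhs coeff_rhs
    unfolding fps_of_nat [symmetric] fps_mult_left_const_nth
    by (simp only: algebra_simps)
  then have "M (Suc (Suc n)) (Suc j) = fact (Suc n) *
      (of_nat (Suc j) * b $ Suc n - y * (a $ Suc n + x * a $ n) -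
      (1 + x) * (of_nat (Suc n) * a $ Suc n) - x * (of_nat n * a $ n)) / fact (Suc j)"
    by (simp only: M fact_Suc [of "Suc n"] of_nat_mult mult_ac)
  also have "\<dots> = fact (Suc n) * (of_nat (Suc j) * b $ Suc n) / fact (Suc j) -
      (y + (1 + x) * of_nat (Suc n)) * (fact (Suc n) * a $ Suc n / fact (Suc j)) -
      x * (of_nat n + y) * (fact (Suc n) * a $ n / fact (Suc j))"
    by (simp add: diff_divide_distrib add_divide_distrib algebra_simps del: fact_Suc of_nat_Suc)
  \<comment> \<open>The factor j + 1 from differentiating the power lowers (j+1)! to j!, which
    produces an entry of the previous column.\<close>
  also have "fact (Suc n) * (of_nat (Suc j) * b $ Suc n) / fact (Suc j) = M (Suc n) j"
    unfolding M fact_Suc [of j] by (simp del: of_nat_Suc fact_Suc)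
  also have "x * (of_nat n + y) * (fact (Suc n) * a $ n / fact (Suc j)) =
      x * of_nat (Suc n) * (of_nat n + y) * M n (Suc j)"
    unfolding M fact_Suc [of n] by (simp del: of_nat_Suc fact_Suc)
  finally show "M (Suc (Suc n)) (Suc j) =
      M (Suc n) j - (y + (1 + x) * of_nat (Suc n)) * M (Suc n) (Suc j) -
      x * of_nat (Suc n) * (of_nat n + y) * M n (Suc j)"
    unfolding M .
  have "of_nat (Suc (Suc n)) * g $ Suc (Suc n) =
      - (y * (g $ Suc n + x * g $ n)) -
      (1 + x) * (of_nat (Suc n) * g $ Suc n) - x * (of_nat n * g $ n)"
    using arg_cong [OF meixner_column_0_ode, of "\<lambda>u. u $ Suc n"]
    unfolding fps_neg_nth coeff_lhs coeff_rhs by (simp only: algebra_simps)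
  then have "M (Suc (Suc n)) 0 = fact (Suc n) *
      (- (y * (g $ Suc n + x * g $ n)) -
      (1 + x) * (of_nat (Suc n) * g $ Suc n) - x * (of_nat n * g $ n))"
    by (simp only: M fact_Suc [of "Suc n"] of_nat_mult mult_ac)
  also have "\<dots> = - (y + (1 + x) * of_nat (Suc n)) * M (Suc n) 0 -
      x * of_nat (Suc n) * (of_nat n + y) * M n 0"
    unfolding M fact_Suc [of n] by (simp add: algebra_simps del: of_nat_Suc fact_Suc)
  finally show "M (Suc (Suc n)) 0 = - (y + (1 + x) * of_nat (Suc n)) * M (Suc n) 0 -
      x * of_nat (Suc n) * (of_nat n + y) * M n 0" .
qed

lemma meixner_orthogonal:
  assumes "x \<noteq> 0" "\<And>n. of_nat n + y \<noteq> 0"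
  shows "orthogonal_with_moments (row_poly (exp_riordan g f)) (\<lambda>n. exp_riordan g' f' n 0)"
proof -
  let ?M = "exp_riordan g f" and ?M' = "exp_riordan g' f'"
  \<comment> \<open>These belong to z p_(n+1), so the indices are one higher than in the recurrence
    for z p_n.\<close>
  let ?b = "\<lambda>n. y + (1 + x) * of_nat (Suc n)" and ?c = "\<lambda>n. x * of_nat (Suc n) * (of_nat n + y)"
  have lt: "lower_triangular ?M"
    using meixner_f_nth by (intro lower_triangular_exp_riordan)
  have coeff: "coeff (row_poly ?M n) j = ?M n j" for n j
    using lt by (rule coeff_row_poly)
  have diag: "?M n n = 1" for n
    using exp_riordan_diag [of f g n] meixner_f_nth meixner_g_nth_0 by simp
  have degree: "degree (row_poly ?M n) = n" for n
  proof (rule antisym)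
    show "degree (row_poly ?M n) \<le> n"
      using lt by (intro degree_le) (simp add: coeff lower_triangular_def)
    show "n \<le> degree (row_poly ?M n)"
      by (intro le_degree) (simp add: coeff diag)
  qed
  have L: "moment_functional (\<lambda>n. ?M' n 0) (row_poly ?M n) = lt_one n 0" for n
    using meixner_lt_inverse by (simp add: moment_functional_row_poly lt_inverse_def)
  have "monom 1 1 * row_poly ?M (Suc n) = row_poly ?M (Suc (Suc n)) +
      smult (?b n) (row_poly ?M (Suc n)) + smult (?c n) (row_poly ?M n)" for n
  proof (rule poly_eqI)
    fix j
    show "coeff (monom 1 1 * row_poly ?M (Suc n)) j = coeff (row_poly ?M (Suc (Suc n)) +
      smult (?b n) (row_poly ?M (Suc n)) + smult (?c n) (row_poly ?M n)) j"
      \<comment> \<open>Multiplication by z shifts coefficients: it contributes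
        \<open>?M (Suc n) (j - 1)\<close> for positive \<open>j\<close> and nothing for
        \<open>j = 0\<close>, matching the two recurrences.\<close>
      by (cases j) (simp_all only: coeff_add coeff_smult coeff coeff_monom_mult meixner_recurrence,
        simp_all add: algebra_simps)
  qed
  moreover have "?c n \<noteq> 0" for n
    using assms by (simp del: of_nat_Suc)
  ultimately show ?thesis
    by (intro favard [where b = ?b and c = ?c])
      (simp_all only: L degree coeff diag, simp_all add: lt_one_def)
qed

end

section \<open>Specialisation to the indeterminates\<close>

lemma indet_x_neq_0: "indet_x \<noteq> 0"
  by (simp add: indet_x_def)

lemma indet_x_neq_1: "indet_x \<noteq> 1"
proof
  assume "indet_x = 1"
  then have "to_fract [:[:0, 1:]:] = to_fract (1 :: rat poly poly)"
    by (simp add: indet_x_def)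
  then show False
    by (simp add: one_pCons)
qed

lemma of_nat_plus_indet_y_neq_0: "of_nat n + indet_y \<noteq> 0"
proof
  have "of_nat n = (to_fract (of_nat n) :: ratfun_xy)"
    by (induction n) simp_all
  moreover assume "of_nat n + indet_y = 0"
  \<comment> \<open>By injectivity of \<open>to_fract\<close> the polynomial n + y itself would
    vanish, but its coefficient of y is 1.\<close>
  ultimately have "to_fract (of_nat n + [:0, 1:] :: rat poly poly) = 0"
    by (simp add: indet_y_def)
  then show False
    by (simp add: of_nat_poly)
qed

theorem proposition5:
  fixes x y :: ratfun_xy
    and F :: "nat \<Rightarrow> ratfun_xy"
    and g f g' f' :: "ratfun_xy fps"
    and M M' :: "nat \<Rightarrow> nat \<Rightarrow> ratfun_xy"
  assumes "x = indet_x" and "y = indet_y"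
    and "F = savage_viswanathan x y"
    and "g = 1 / fps_powr (1 + fps_X) y"
    and "f = fps_const (1 / (1 - x)) * fps_log ((1 + fps_X) / (1 + fps_const x * fps_X))"
    and "M = exp_riordan g f"
    and "g' = fps_powr (fps_const (1 - x) / (fps_exp (x - 1) - fps_const x)) y"
    and "f' = (fps_exp 1 - fps_exp x) / (fps_exp x - fps_const x * fps_exp 1)"
    and "M' = exp_riordan g' f'"
  shows "riordan_pair g f \<and>
         (\<exists>p. coefficient_array M p \<and> orthogonal_with_moments p F) \<and>
         riordan_pair g' f' \<and> lt_inverse M M' \<and>
         (\<forall>n. M' n 0 = F n)"
proof -
  note [simp] = assms(1-3)
  have x: "x \<noteq> 1" "x \<noteq> 0" and y: "of_nat n + y \<noteq> 0" for n
    using indet_x_neq_0 indet_x_neq_1 of_nat_plus_indet_y_neq_0 by simp_all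
  have gf: "riordan_pair g f"
    unfolding riordan_pair_def assms(4,5)
    using meixner_g_nth_0 [OF x(1), of y] meixner_f_nth [OF x(1)] by simp
  have g'f': "riordan_pair g' f'"
    unfolding riordan_pair_def assms(7,8)
    using meixner_f'_nth_0 [OF x(1)] meixner_f'_nth_1 [OF x(1)] by simp
  have inv: "lt_inverse M M'"
    unfolding assms(4-9) using x(1) by (rule meixner_lt_inverse)
  \<comment> \<open>Column 0 has generating function \<open>g'\<close>, which is literally the
    defining series of the polynomials.\<close>
  have col: "M' n 0 = F n" for n
    unfolding assms(3) savage_viswanathan_def savage_viswanathan_egf_def assms(9,7)
    by (simp add: exp_riordan_def)
  have "orthogonal_with_moments (row_poly M) (\<lambda>n. M' n 0)"
    unfolding assms(4-9) using x y by (rule meixner_orthogonal)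
  then have "orthogonal_with_moments (row_poly M) F"
    by (simp only: col)
  moreover have "coefficient_array M (row_poly M)"
    using inv by (simp add: coefficient_array_def lt_inverse_def row_poly_def)
  ultimately show ?thesis
    using gf g'f' inv col by blast
qed

end
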